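(* Let $t\in\mathbb Q$, $t\ne0,\pm1,\pm2$, be circular, with $t^2+a^2=4$, $a\in\mathbb Q$. If $t$ is primitive and circular primitive, then the torsion subgroup of the Laxton group $\mathcal G(t)$ is isomorphic to $\mathbb Z_2\times\mathbb Z_4$. The elements $I$, $C=[2\ t]$, $G=[2\ t+a]$, $H=[2\ t-a]$ form a subgroup of it isomorphic to $\mathbb Z_4$, and the other four elements of the torsion subgroup are obtained from these by translation (multiplication) by $W=[-1\ 1]$.
   Context: For $t\in\mathbb Q$ let $D_t=\begin{pmatrix}0&-1\\1&t\end{pmatrix}$ and let $\mathcal R(t)$ be the commutative ring of all $2\times2$ rational matrices commuting with $D_t$; its elements are the matrices $[x_0\ x_1]:=\begin{pmatrix}x_1-tx_0&-x_0\\ x_0&x_1\end{pmatrix}$, $x_0,x_1\in\mathbb Q$ (so $I=[0\ 1]$). The sequence group $\mathcal L(t)$ is the commutative group of elements of $\mathcal R(t)$ with nonzero determinant modulo multiplication by nonzero rational scalars. The Laxton group is $\mathcal G(t)=\mathcal L(t)/\langle D_t\rangle$, the quotient by the cyclic subgroup generated by the class of $D_t$; elements of $\mathcal R(t)$ with nonzero determinant are used to denote their classes. Let $C_r(t)=\operatorname{tr}D_t^r$ (Chebyshev polynomials: $C_0=2$, $C_1(t)=t$, $C_{n+1}=tC_n-C_{n-1}$). A rational $t$ is $r$-primitive if there is no rational $u$ with $t=C_r(u)$; it is primitive if it is $r$-primitive for all natural $r\ge2$. $t$ is circular if $t^2+a^2=4$ for some rational $a$; such $a$ are the associate values of $t$.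 A circular $t$ is circular primitive if $t$ and its associate values are $2$-primitive. *)

theory Defs
  imports "HOL-Analysis.Determinants" "HOL-Algebra.Elementary_Groups" "HOL-Algebra.Ring"
begin

definition mat_D :: "rat \<Rightarrow> rat^2^2" where
  "mat_D t = vector [vector [0, -1], vector [1, t]]"

definition ring_R :: "rat \<Rightarrow> (rat^2^2) ring" where
  "ring_R t = \<lparr>carrier = {A. A ** mat_D t = mat_D t ** A}, mult = (**), one = mat 1, zero = 0, add = (+)\<rparr>"

text \<open>The matrix written $[x_0\ x_1]$, which depends on $t$.\<close>

definition elt :: "rat \<Rightarrow> rat \<Rightarrow> rat \<Rightarrow> rat^2^2" where
  "elt t x0 x1 = vector [vector [x1 - t * x0, - x0], vector [x0, x1]]"

definition R_nonsing :: "rat \<Rightarrow> (rat^2^2) monoid" where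
  "R_nonsing t = \<lparr>carrier = {A \<in> carrier (ring_R t). det A \<noteq> 0}, mult = (**), one = mat 1\<rparr>"

definition scalars :: "(rat^2^2) set" where
  "scalars = {mat c | c. c \<noteq> 0}"

definition sequence_group :: "rat \<Rightarrow> (rat^2^2) set monoid" where
  "sequence_group t = R_nonsing t Mod scalars"

definition L_class :: "rat \<Rightarrow> rat^2^2 \<Rightarrow> (rat^2^2) set" where
  "L_class t A = scalars #>\<^bsub>R_nonsing t\<^esub> A"

definition D_subgroup :: "rat \<Rightarrow> (rat^2^2) set set" where
  "D_subgroup t = generate (sequence_group t) {L_class t (mat_D t)}"

definition laxton_group :: "rat \<Rightarrow> (rat^2^2) set set monoid" where
  "laxton_group t = sequence_group t Mod D_subgroup t"

definition G_class :: "rat \<Rightarrow> rat^2^2 \<Rightarrow> (rat^2^2) set set" where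
  "G_class t A = D_subgroup t #>\<^bsub>sequence_group t\<^esub> L_class t A"

definition torsion :: "('a, 'b) monoid_scheme \<Rightarrow> 'a set" where
  "torsion G = {x \<in> carrier G. \<exists>n::nat. n > 0 \<and> x [^]\<^bsub>G\<^esub> n = \<one>\<^bsub>G\<^esub>}"

text \<open>The power \<open>(^)\<close> on the type of matrices is componentwise, so the matrix power is
  written as an iteration of \<open>(**)\<close>.\<close>

definition cheb :: "nat \<Rightarrow> rat \<Rightarrow> rat" where
  "cheb r t = trace ((((**) (mat_D t)) ^^ r) (mat 1))"

definition r_primitive :: "nat \<Rightarrow> rat \<Rightarrow> bool" where
  "r_primitive r t \<longleftrightarrow> \<not> (\<exists>u. t = cheb r u)"

definition primitive :: "rat \<Rightarrow> bool" where
  "primitive t \<longleftrightarrow> (\<forall>r\<ge>2. r_primitive r t)"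

definition associate_values :: "rat \<Rightarrow> rat set" where
  "associate_values t = {a. t\<^sup>2 + a\<^sup>2 = 4}"

definition circular :: "rat \<Rightarrow> bool" where
  "circular t \<longleftrightarrow> associate_values t \<noteq> {}"

definition circular_primitive :: "rat \<Rightarrow> bool" where
  "circular_primitive t \<longleftrightarrow>
     circular t \<and> r_primitive 2 t \<and> (\<forall>a\<in>associate_values t. r_primitive 2 a)"

lemmas mat2_simps = vec_eq_iff forall_2 sum_2 matrix_matrix_mult_def mat_def det_2

lemma carrier_R: "carrier (ring_R t) = {elt t x0 x1 | x0 x1. True}"
proof -
  have "A = elt t (A$2$1) (A$2$2)" if "A ** mat_D t = mat_D t ** A" for A
  proof -
    have "(A ** mat_D t) $ i $ j = (mat_D t ** A) $ i $ j" for i j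
      using that by simp
    from this[of 1 1] this[of 2 1]
    have "A$1$2 = - A$2$1" "A$2$2 = A$1$1 + t * A$2$1"
      by (simp_all add: matrix_matrix_mult_def sum_2 mat_D_def)
    then show ?thesis
      by (simp add: vec_eq_iff forall_2 elt_def)
  qed
  moreover have "elt t x0 x1 ** mat_D t = mat_D t ** elt t x0 x1" for x0 x1
    by (simp add: mat2_simps elt_def mat_D_def algebra_simps)
  ultimately show ?thesis by (auto simp: ring_R_def)
qed

lemma elt_one: "elt t 0 1 = mat 1"
  by (simp add: mat2_simps elt_def)

lemma elt_mult_commute: "elt t x0 x1 ** elt t y0 y1 = elt t y0 y1 ** elt t x0 x1"
  by (simp add: mat2_simps elt_def algebra_simps)

lemma det_D [simp]: "det (mat_D t) = 1"
  by (simp add: mat2_simps mat_D_def)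

lemma mat2_add_rdistrib: "(A + B) ** C = A ** C + B ** C" for A B C :: "rat^2^2"
  by (simp add: vec_eq_iff matrix_matrix_mult_def sum_2 algebra_simps)

lemma cring_R: "cring (ring_R t)"
proof (rule cringI)
  show "abelian_group (ring_R t)"
  proof (rule abelian_groupI)
    show "\<exists>y\<in>carrier (ring_R t). y \<oplus>\<^bsub>ring_R t\<^esub> A = \<zero>\<^bsub>ring_R t\<^esub>" if "A \<in> carrier (ring_R t)" for A
    proof -
      obtain x0 x1 where A: "A = elt t x0 x1" using \<open>A \<in> carrier (ring_R t)\<close> by (auto simp: carrier_R)
      have "elt t (- x0) (- x1) + A = 0" by (simp add: A vec_eq_iff forall_2 elt_def)
      then show ?thesis
        by (intro bexI[of _ "elt t (- x0) (- x1)"]) (auto simp: carrier_R, simp add: ring_R_def)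
    qed
  qed (auto simp: ring_R_def matrix_add_ldistrib mat2_add_rdistrib add_ac)
  show "comm_monoid (ring_R t)"
  proof (rule comm_monoidI)
    show "A \<otimes>\<^bsub>ring_R t\<^esub> B \<in> carrier (ring_R t)"
      if "A \<in> carrier (ring_R t)" "B \<in> carrier (ring_R t)" for A B
    proof -
      have "A ** B ** mat_D t = A ** (mat_D t ** B)"
        using that by (simp add: ring_R_def flip: matrix_mul_assoc)
      also have "\<dots> = mat_D t ** (A ** B)"
        using that by (simp add: ring_R_def matrix_mul_assoc)
      finally show ?thesis by (simp add: ring_R_def)
    qed
    show "A \<otimes>\<^bsub>ring_R t\<^esub> B = B \<otimes>\<^bsub>ring_R t\<^esub> A" if "A \<in> carrier (ring_R t)" "B \<in> carrier (ring_R t)" for A B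
      using that by (auto simp: carrier_R) (simp add: ring_R_def elt_mult_commute)
  qed (auto simp: ring_R_def matrix_mul_assoc)
qed (auto simp: ring_R_def matrix_add_ldistrib mat2_add_rdistrib)

lemma comm_group_R_nonsing: "comm_group (R_nonsing t)"
proof (rule comm_groupI)
  interpret cring "ring_R t" by (rule cring_R)
  fix A B
  assume A: "A \<in> carrier (R_nonsing t)" and B: "B \<in> carrier (R_nonsing t)"
  show "A \<otimes>\<^bsub>R_nonsing t\<^esub> B \<in> carrier (R_nonsing t)"
    using A B m_closed[of A B] by (auto simp: R_nonsing_def det_mul ring_R_def)
  show "A \<otimes>\<^bsub>R_nonsing t\<^esub> B = B \<otimes>\<^bsub>R_nonsing t\<^esub> A"
    using A B m_comm[of A B] by (auto simp: R_nonsing_def ring_R_def)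
next
  fix A assume A: "A \<in> carrier (R_nonsing t)"
  then obtain x0 x1 where x: "A = elt t x0 x1" "det A \<noteq> 0"
    by (auto simp: R_nonsing_def carrier_R)
  define d where "d = det A"
  have d: "d \<noteq> 0" "d = (x1 - t * x0) * x1 + x0 * x0"
    using x(2) by (simp_all add: d_def) (simp add: x(1) det_2 elt_def)
  let ?B = "elt t (- x0 / d) ((x1 - t * x0) / d)"
  have "elt t (- x0) (x1 - t * x0) ** A = mat d"
    unfolding x(1) d(2) by (simp add: mat2_simps elt_def algebra_simps)
  moreover have "?B = (\<chi> i j. (1 / d) * elt t (- x0) (x1 - t * x0) $ i $ j)"
    by (simp add: vec_eq_iff forall_2 elt_def diff_divide_distrib)
  ultimately have BA: "?B ** A = mat 1"
    using d(1) by (simp add: vec_eq_iff forall_2 matrix_matrix_mult_def sum_2 mat_def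
        flip: add_divide_distrib)
  from this have "det ?B * det A = 1"
    by (metis det_mul det_I)
  with BA show "\<exists>y\<in>carrier (R_nonsing t). y \<otimes>\<^bsub>R_nonsing t\<^esub> A = \<one>\<^bsub>R_nonsing t\<^esub>"
    by (intro bexI[of _ ?B]) (auto simp: R_nonsing_def carrier_R)
qed (auto simp: R_nonsing_def ring_R_def matrix_mul_assoc)

lemma subgroup_scalars: "subgroup scalars (R_nonsing t)"
proof -
  interpret comm_group "R_nonsing t" by (rule comm_group_R_nonsing)
  have mult: "mat c ** mat d = (mat (c * d) :: rat^2^2)" for c d
    by (simp add: mat2_simps)
  have car: "mat c \<in> carrier (R_nonsing t)" if "c \<noteq> 0" for c
    using that by (simp add: R_nonsing_def ring_R_def mat2_simps)
  show ?thesis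
  proof (rule subgroupI)
    show "scalars \<subseteq> carrier (R_nonsing t)" "scalars \<noteq> {}"
      using car by (auto simp: scalars_def intro: exI[of _ 1])
  next
    fix A assume "A \<in> scalars"
    then obtain c where c: "A = mat c" "c \<noteq> 0" by (auto simp: scalars_def)
    have "inv\<^bsub>R_nonsing t\<^esub> A = mat (1 / c)"
      using c car by (intro inv_equality) (auto simp: mult R_nonsing_def)
    then show "inv\<^bsub>R_nonsing t\<^esub> A \<in> scalars" using c by (auto simp: scalars_def)
  next
    fix A B assume "A \<in> scalars" "B \<in> scalars"
    then show "A \<otimes>\<^bsub>R_nonsing t\<^esub> B \<in> scalars"
      by (force simp: scalars_def R_nonsing_def mult)
  qed
qed

lemma comm_group_sequence_group: "comm_group (sequence_group t)"
  unfolding sequence_group_def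
  by (intro comm_group.abelian_FactGroup comm_group_R_nonsing subgroup_scalars)

lemma L_class_closed: "A \<in> carrier (R_nonsing t) \<Longrightarrow> L_class t A \<in> carrier (sequence_group t)"
  by (auto simp: L_class_def sequence_group_def FactGroup_def RCOSETS_def)

lemma subgroup_D_subgroup: "subgroup (D_subgroup t) (sequence_group t)"
proof -
  interpret comm_group "sequence_group t" by (rule comm_group_sequence_group)
  have "mat_D t \<in> carrier (R_nonsing t)"
    by (simp add: R_nonsing_def ring_R_def)
  then show ?thesis
    unfolding D_subgroup_def by (intro generate_is_subgroup) (simp add: L_class_closed)
qed

lemma comm_group_laxton_group: "comm_group (laxton_group t)"
  unfolding laxton_group_def
  by (intro comm_group.abelian_FactGroup comm_group_sequence_group subgroup_D_subgroup)

lemma subgroup_torsion: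
  assumes "comm_group G"
  shows "subgroup (torsion G) G"
proof -
  interpret comm_group G by fact
  show ?thesis
  proof (rule subgroupI)
    show "torsion G \<noteq> {}" by (auto simp: torsion_def intro!: exI[of _ "\<one>\<^bsub>G\<^esub>"] exI[of _ 1])
  next
    fix x assume "x \<in> torsion G"
    then show "inv\<^bsub>G\<^esub> x \<in> torsion G" by (auto simp: torsion_def nat_pow_inv)
  next
    fix x y assume "x \<in> torsion G" "y \<in> torsion G"
    then obtain m n :: nat where x: "x \<in> carrier G" "m > 0" "x [^]\<^bsub>G\<^esub> m = \<one>\<^bsub>G\<^esub>"
      and y: "y \<in> carrier G" "n > 0" "y [^]\<^bsub>G\<^esub> n = \<one>\<^bsub>G\<^esub>" by (auto simp: torsion_def)
    have "x [^]\<^bsub>G\<^esub> (m * n) = \<one>\<^bsub>G\<^esub>" "y [^]\<^bsub>G\<^esub> (m * n) = \<one>\<^bsub>G\<^esub>"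
      using x y by (metis nat_pow_pow nat_pow_one, metis nat_pow_pow nat_pow_one mult.commute)
    then have "(x \<otimes>\<^bsub>G\<^esub> y) [^]\<^bsub>G\<^esub> (m * n) = \<one>\<^bsub>G\<^esub>"
      using x y by (simp add: nat_pow_distrib)
    then show "x \<otimes>\<^bsub>G\<^esub> y \<in> torsion G" using x y
      by (auto simp: torsion_def intro!: exI[of _ "m * n"])
  qed (auto simp: torsion_def)
qed

lemma cheb_0: "cheb 0 t = 2"
  by (simp add: cheb_def trace_def mat2_simps)

lemma cheb_1: "cheb (Suc 0) t = t"
  by (simp add: cheb_def trace_def mat2_simps mat_D_def)

lemma cheb_rec: "cheb (Suc (Suc n)) t = t * cheb (Suc n) t - cheb n t"
  by (simp add: cheb_def trace_def mat2_simps mat_D_def algebra_simps)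

end

theory Submission
  imports Defs
begin

text \<open>
  For circular \<open>t\<close> other than \<open>2\<close> and \<open>-2\<close> the ring of matrices commuting with \<open>D\<^sub>t\<close> is the field of Gaussian rationals, and \<open>D\<^sub>t\<close> becomes the point
  \<open>D = (t + a \<i>) / 2\<close> of the unit circle (\<open>circular_parameter\<close>).  By Hilbert 90 the map \<open>z \<mapsto> z / cnj z\<close> identifies the
  nonzero Gaussian rationals modulo nonzero rationals with rational points of the unit circle.  It sends \<open>D\<close> to its square,
  so the Laxton group is a group of rational points of the circle modulo the powers of \<open>D\<^sup>2\<close> (\<open>G_class_eq_iff\<close>).

  A torsion element is then a point \<open>u\<close> with \<open>u\<^sup>n\<close> a power of \<open>D\<close>.  The only roots of unity in the field are the four powers of
  \<open>\<i>\<close> (\<open>gaussian_root_of_unity\<close>).  Since \<open>C\<^sub>r(w + 1/w) = w\<^sup>r + 1/w\<^sup>r\<close>, primitivity of \<open>t\<close> says that \<open>D\<close> is not a proper power on the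
  circle, and circular primitivity that no multiple of \<open>D\<close> by a power of \<open>\<i>\<close> is a square.  A Bezout argument
  (\<open>torsion_modulo_nonpower\<close>) concludes that \<open>u\<close> is a power of \<open>\<i>\<close> times a power of \<open>D\<close>.

  So the torsion consists of the classes of \<open>\<i>\<^sup>m D\<^sup>j\<close> modulo \<open>D\<^sup>2\<close>, where \<open>D\<close> has infinite order: it is the product of the cyclic group
  of order 4 generated by \<open>\<i>\<close> and the group of order 2 generated by \<open>D\<close>.  The matrices \<open>G\<close> and \<open>W\<close> are preimages of \<open>\<i>\<close> and of \<open>1 / D\<close>.
\<close>

section \<open>Recognising the product of cyclic groups of orders 2 and 4\<close>

lemma (in monoid) nat_pow_mod:
  assumes "x \<in> carrier G" "x [^] (k :: nat) = \<one>"
  shows "x [^] (n mod k) = x [^] n"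
proof -
  have "x [^] n = x [^] (k * (n div k) + n mod k)" by simp
  also have "\<dots> = (x [^] k) [^] (n div k) \<otimes> x [^] (n mod k)"
    using assms(1) by (simp only: nat_pow_mult nat_pow_pow)
  finally show ?thesis using assms by simp
qed

lemma int_interval_4: "{0..<4} = {0, 1, 2, 3 :: int}"
  by auto

context comm_group
begin

text \<open>The relations below say that \<open>g\<close> has order 4 with powers \<open>c\<close> and \<open>h\<close>, and that \<open>w\<close> is an involution outside the cyclic
  group generated by \<open>g\<close>.  They are stated with products alone, without powers, so that they can be checked on representatives.\<close>

context
  fixes g c h w S
  assumes g: "g \<in> carrier G" and w: "w \<in> carrier G"
    and c: "g \<otimes> g = c" and h: "g \<otimes> c = h"
    and cc: "c \<otimes> c = \<one>" and ww: "w \<otimes> w = \<one>"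
    and c1: "c \<noteq> \<one>" and S: "S = {\<one>, c, g, h}" and wS: "w \<notin> S"
begin

lemma pow_4_eq_one: "g [^] (4 :: nat) = \<one>"
  and small_powers: "g [^] (0 :: nat) = \<one>" "g [^] (1 :: nat) = g" "g [^] (2 :: nat) = c" "g [^] (3 :: nat) = h"
proof -
  have 2: "g [^] (2 :: nat) = c" using g c by (simp add: numeral_2_eq_2)
  show "g [^] (2 :: nat) = c" by fact
  have "g [^] (3 :: nat) = g \<otimes> g \<otimes> g" using g by (simp add: numeral_3_eq_3)
  then show "g [^] (3 :: nat) = h" using c h g m_assoc by metis
  have "g [^] (4 :: nat) = g [^] (2 :: nat) \<otimes> g [^] (2 :: nat)" using g by (subst nat_pow_mult) simp_all
  then show "g [^] (4 :: nat) = \<one>" using 2 cc by simp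
qed (use g in simp_all)

lemma S_eq_powers: "S = (\<lambda>j. g [^] nat j) ` {0..<4}"
  unfolding int_interval_4 using small_powers by (auto simp: S)

lemma pow_in_S: "g [^] (n :: nat) \<in> S"
proof -
  have "g [^] n = g [^] nat (int (n mod 4))"
    using nat_pow_mod[OF g pow_4_eq_one, of n] by simp
  then show ?thesis unfolding S_eq_powers by (rule image_eqI) auto
qed

lemma pow_eq_one_imp: "g [^] nat j = \<one> \<Longrightarrow> j \<in> {0..<4} \<Longrightarrow> j = 0"
proof -
  have "g \<noteq> \<one>" using c c1 by auto
  moreover have "h \<noteq> \<one>"
  proof
    assume "h = \<one>"
    then have "g \<otimes> c = c \<otimes> c" using h cc by simp
    then have "g = c" using g c by (metis m_closed right_cancel)
    then show False using c cc c1 by simp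
  qed
  moreover assume "g [^] nat j = \<one>" "j \<in> {0..<4}"
  ultimately show "j = 0" unfolding int_interval_4 using small_powers c1 by auto
qed

lemma hom_powers: "(\<lambda>j. g [^] nat j) \<in> hom (integer_mod_group 4) (G\<lparr>carrier := S\<rparr>)"
proof (rule homI)
  fix i j assume "i \<in> carrier (integer_mod_group 4)" "j \<in> carrier (integer_mod_group 4)"
  then have "nat ((i + j) mod int 4) = (nat i + nat j) mod 4"
    by (simp add: carrier_integer_mod_group nat_mod_distrib nat_add_distrib)
  then show "g [^] nat (i \<otimes>\<^bsub>integer_mod_group 4\<^esub> j) = g [^] nat i \<otimes>\<^bsub>G\<lparr>carrier := S\<rparr>\<^esub> g [^] nat j"
    using nat_pow_mod[OF g pow_4_eq_one] g by (simp add: nat_pow_mult)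
qed (simp add: pow_in_S)

lemma subgroup_S: "subgroup S G"
proof (rule subgroupI)
  show "S \<subseteq> carrier G" using g by (auto simp: S_eq_powers)
  show "S \<noteq> {}" by (simp add: S)
  fix x y assume x: "x \<in> S" and "y \<in> S"
  then obtain m n :: nat where mn: "x = g [^] m" "y = g [^] n"
    unfolding S_eq_powers by blast
  then have "x \<otimes> y = g [^] (m + n)" using g by (simp add: nat_pow_mult)
  then show "x \<otimes> y \<in> S" by (simp add: pow_in_S)
  have "g [^] (3 * m) \<otimes> x = (g [^] (4 :: nat)) [^] m"
    using g by (simp only: mn nat_pow_mult nat_pow_pow) (simp add: algebra_simps)
  then have "inv x = g [^] (3 * m)"
    using g mn pow_4_eq_one by (intro inv_equality) auto
  then show "inv x \<in> S" by (simp add: pow_in_S)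
qed

lemma S_iso_Z4: "G\<lparr>carrier := S\<rparr> \<cong> integer_mod_group 4"
proof -
  have gS: "group (G\<lparr>carrier := S\<rparr>)" by (intro subgroup_imp_group subgroup_S)
  interpret f: group_hom "integer_mod_group 4" "G\<lparr>carrier := S\<rparr>" "\<lambda>j. g [^] nat j"
    using hom_powers gS by (simp add: group_hom_def group_hom_axioms_def)
  have "inj_on (\<lambda>j. g [^] nat j) (carrier (integer_mod_group 4))"
    by (subst f.inj_on_one_iff) (use pow_eq_one_imp in \<open>simp add: carrier_integer_mod_group\<close>)
  then have "(\<lambda>j. g [^] nat j) \<in> iso (integer_mod_group 4) (G\<lparr>carrier := S\<rparr>)"
    using hom_powers S_eq_powers by (simp add: iso_def bij_betw_def carrier_integer_mod_group)
  then show ?thesis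
    using group.iso_sym[OF group_integer_mod_group] by (auto simp: is_iso_def)
qed

text \<open>The two cosets \<open>S\<close> and \<open>w S\<close> are different, since \<open>w\<close> lies outside the subgroup \<open>S\<close>.  This gives both the
  complement of \<open>S\<close> and the injectivity of the map from the direct product.\<close>

lemma w_translate_disjoint: "x \<in> S \<Longrightarrow> w \<otimes> x \<notin> S"
proof
  assume x: "x \<in> S" and wx: "w \<otimes> x \<in> S"
  have xc: "x \<in> carrier G" using subgroup.mem_carrier[OF subgroup_S x] .
  have "w \<otimes> x \<otimes> inv x \<in> S"
    using subgroup_S x wx by (meson subgroup.m_closed subgroup.m_inv_closed)
  then show False using wS w xc by (simp add: m_assoc)
qed

context
  assumes cover: "carrier G = S \<union> (\<lambda>x. w \<otimes> x) ` S"
begin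

lemma complement_S: "carrier G - S = (\<lambda>x. w \<otimes> x) ` S"
  using cover w_translate_disjoint by auto

lemma iso_Z2_Z4: "G \<cong> integer_mod_group 2 \<times>\<times> integer_mod_group 4"
proof -
  let ?P = "integer_mod_group 2 \<times>\<times> integer_mod_group 4"
  let ?f = "\<lambda>(i, j). w [^] nat i \<otimes> g [^] nat j"
  have w2: "w [^] (2 :: nat) = \<one>" using w ww by (simp add: numeral_2_eq_2)
  have hom: "?f \<in> hom ?P G"
  proof (rule homI)
    fix x y assume "x \<in> carrier ?P" "y \<in> carrier ?P"
    then obtain i j i' j' where xy: "x = (i, j)" "y = (i', j')"
      and ij: "i \<ge> 0" "i' \<ge> 0" "j \<ge> 0" "j' \<ge> 0"
      by (auto simp: carrier_integer_mod_group)
    have e: "nat ((i + i') mod int 2) = (nat i + nat i') mod 2" "nat ((j + j') mod int 4) = (nat j + nat j') mod 4"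
      using ij by (simp_all add: nat_mod_distrib nat_add_distrib)
    show "?f (x \<otimes>\<^bsub>?P\<^esub> y) = ?f x \<otimes> ?f y"
      using nat_pow_mod[OF g pow_4_eq_one] nat_pow_mod[OF w w2] g w e
      by (simp add: xy m_ac flip: nat_pow_mult)
  qed (use g w in auto)
  have gP: "group ?P" by (intro DirProd_group) simp_all
  interpret f: group_hom ?P G ?f
    using hom gP by (simp add: group_hom_def group_hom_axioms_def group_axioms)
  have kernel: "x = \<one>\<^bsub>?P\<^esub>" if "x \<in> carrier ?P" and 1: "?f x = \<one>" for x
  proof -
    from that obtain i j where x: "x = (i, j)" and j: "j \<in> {0..<4}" and i: "i = 0 \<or> i = 1"
      by (force simp: carrier_integer_mod_group)
    have "i \<noteq> 1"
    proof
      assume "i = 1"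
      then have "w \<otimes> g [^] nat j = \<one>" using 1 w by (simp add: x)
      then show False using w_translate_disjoint[OF pow_in_S[of "nat j"]] by (simp add: S)
    qed
    with i have "i = 0" by simp
    moreover from this have "g [^] nat j = \<one>" using 1 g by (simp add: x)
    ultimately show ?thesis using pow_eq_one_imp j by (simp add: x)
  qed
  then have "inj_on ?f (carrier ?P)"
    by (subst f.inj_on_one_iff) blast
  moreover have "?f ` carrier ?P = carrier G"
  proof (intro equalityI subsetI)
    fix y assume "y \<in> carrier G"
    then consider "y \<in> S" | x where "x \<in> S" "y = w \<otimes> x" using cover by auto
    then show "y \<in> ?f ` carrier ?P"
    proof cases
      case 1
      then obtain j where "j \<in> {0..<4}" "y = g [^] nat j" by (auto simp: S_eq_powers)
      then show ?thesis using g
        by (intro image_eqI[of _ _ "(0, j)"]) (simp_all add: carrier_integer_mod_group)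
    next
      case 2
      then obtain j where "j \<in> {0..<4}" "y = w \<otimes> g [^] nat j" by (auto simp: S_eq_powers)
      then show ?thesis using g w
        by (intro image_eqI[of _ _ "(1, j)"]) (simp_all add: carrier_integer_mod_group)
    qed
  qed (use g w in auto)
  ultimately have "?f \<in> iso ?P G"
    using hom by (simp add: iso_def bij_betw_def)
  then show ?thesis
    using group.iso_sym[OF gP] by (auto simp: is_iso_def)
qed

end

end

end

section \<open>Chebyshev polynomials at rational arguments\<close>

text \<open>The number \<open>cheb n x\<close> is a monic polynomial in \<open>x\<close> with integer coefficients.  In the form
  needed for the rational root theorem this says: after clearing the
  denominator \<open>q\<close> of \<open>x = p / q\<close>, the numerator of \<open>cheb n x\<close> is the leading term \<open>p ^ n\<close> plus a multiple
  of \<open>q\<close>.  The case \<open>n = 0\<close> has to be left out of the congruence, as \<open>cheb 0 x = 2\<close>.\<close>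

lemma cheb_clear_denominators:
  fixes p q :: int
  assumes "q \<noteq> 0"
  shows "\<exists>s. cheb n (of_int p / of_int q) * of_int q ^ n = of_int s \<and> (0 < n \<longrightarrow> q dvd s - p ^ n)"
proof (induction n rule: less_induct)
  case (less n)
  consider "n = 0" | "n = 1" | m where "n = Suc (Suc m)"
    by (metis One_nat_def not0_implies_Suc)
  then show ?case
  proof cases
    case 1
    then show ?thesis by (auto simp: cheb_0 intro: exI[of _ 2])
  next
    case 2
    then show ?thesis using assms by (auto simp: cheb_1)
  next
    case 3
    obtain s where s: "cheb m (of_int p / of_int q) * of_int q ^ m = of_int s"
      using less[of m] 3 by auto
    obtain r where r: "cheb (Suc m) (of_int p / of_int q) * of_int q ^ Suc m = of_int r"
        "q dvd r - p ^ Suc m"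
      using less[of "Suc m"] 3 by blast
    have "cheb n (of_int p / of_int q) * of_int q ^ n
        = of_int p * (cheb (Suc m) (of_int p / of_int q) * of_int q ^ Suc m)
          - (of_int q)\<^sup>2 * (cheb m (of_int p / of_int q) * of_int q ^ m)"
      using assms by (simp add: 3 cheb_rec field_simps power2_eq_square)
    also have "\<dots> = of_int (p * r - q\<^sup>2 * s)"
      unfolding s r(1) by simp
    finally have 1: "cheb n (of_int p / of_int q) * of_int q ^ n = of_int (p * r - q\<^sup>2 * s)" .
    have "p * r - q\<^sup>2 * s - p ^ n = p * (r - p ^ Suc m) - q * (q * s)"
      by (simp add: 3 algebra_simps power2_eq_square)
    moreover have "q dvd \<dots>" by (intro dvd_diff[OF dvd_mult[OF r(2)]] dvd_triv_left)
    ultimately have "q dvd p * r - q\<^sup>2 * s - p ^ n" by simp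
    with 1 show ?thesis by blast
  qed
qed

lemma cheb_Ints_imp_Ints:
  assumes "cheb n x \<in> \<int>" "n > 0"
  shows "x \<in> \<int>"
proof -
  obtain p q where x: "x = Fract p q" "q > 0" "coprime p q" by (cases x)
  then have x': "x = of_int p / of_int q" by (simp add: Fract_of_int_quotient)
  obtain s where s: "cheb n x * of_int q ^ n = of_int s" "q dvd s - p ^ n"
    using cheb_clear_denominators[of q n p] x assms(2) x' by auto
  obtain c where "cheb n x = of_int c" using assms(1) by (auto elim: Ints_cases)
  with s(1) have "(of_int (c * q ^ n) :: rat) = of_int s" by simp
  then have "s = c * q ^ n" by linarith
  then have "q dvd s" using assms(2) by (simp add: dvd_power)
  with s(2) have "q dvd p ^ n" by (metis dvd_diffD dvd_diff_right_iff)
  moreover have "coprime q (p ^ n)" using x(3) by (simp add: coprime_commute)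
  ultimately have "is_unit q" using coprime_absorb_left by blast
  with x(2) have "q = 1" by simp
  with x' show ?thesis by simp
qed

lemma rat_square_neq_3: "x\<^sup>2 \<noteq> 3" for x :: rat
proof
  assume x: "x\<^sup>2 = 3"
  have "cheb (Suc (Suc 0)) x = x\<^sup>2 - 2"
    by (simp only: cheb_rec cheb_0 cheb_1 power2_eq_square)
  also have "\<dots> \<in> \<int>" by (simp add: x)
  finally have "x \<in> \<int>" by (rule cheb_Ints_imp_Ints) simp
  then obtain k where k: "x = of_int k" by (auto elim: Ints_cases)
  \<comment> \<open>No integer has square 3: the absolute value \<open>m\<close> would be 0 or 1.\<close>
  define m where "m = \<bar>k\<bar>"
  from k x have "(of_int (k\<^sup>2) :: rat) = of_int 3" by simp
  then have m: "m\<^sup>2 = 3" unfolding m_def by (metis of_int_eq_iff power2_abs)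
  then have "m < 2" by (intro power_less_imp_less_base[of m 2 2]) auto
  then have "m = 0 \<or> m = 1" unfolding m_def by linarith
  with m show False by auto
qed

text \<open>The classical identity \<open>C_n (w + 1/w) = w ^ n + 1 / w ^ n\<close> for \<open>w\<close> on the unit circle, where \<open>1 / w\<close> is the conjugate
  of \<open>w\<close>.  It turns the primitivity of a rational number into a statement on powers of points of the circle.\<close>

lemma cheb_sum_conj:
  assumes "norm (w :: complex) = 1" "real_of_rat u = 2 * Re w"
  shows "real_of_rat (cheb n u) = 2 * Re (w ^ n)"
proof (induction n rule: less_induct)
  case (less n)
  consider "n = 0" | "n = 1" | m where "n = Suc (Suc m)"
    by (metis One_nat_def not0_implies_Suc)
  then show ?case
  proof cases
    case 3
    have nn: "(Re w)\<^sup>2 + (Im w)\<^sup>2 = 1"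
      using assms(1) by (simp add: cmod_def)
    \<comment> \<open>The characteristic equation of \<open>w\<close>, which gives the recursion for its powers.\<close>
    have sq: "w\<^sup>2 = of_real (2 * Re w) * w - 1"
      using nn by (simp add: complex_eq_iff power2_eq_square algebra_simps)
    have "w ^ n = w\<^sup>2 * w ^ m" by (simp add: 3 power2_eq_square)
    also have "\<dots> = of_real (2 * Re w) * w ^ Suc m - w ^ m"
      unfolding sq by (simp add: algebra_simps)
    finally have Re_n: "Re (w ^ n) = 2 * Re w * Re (w ^ Suc m) - Re (w ^ m)"
      by (metis Re_complex_of_real Im_complex_of_real minus_complex.sel(1) times_complex.sel(1)
            mult_zero_left diff_zero)
    have IH: "real_of_rat (cheb (Suc m) u) = 2 * Re (w ^ Suc m)" "real_of_rat (cheb m u) = 2 * Re (w ^ m)"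
      by (rule less; simp add: 3)+
    have "real_of_rat (cheb n u) = real_of_rat u * real_of_rat (cheb (Suc m) u) - real_of_rat (cheb m u)"
      by (simp add: 3 cheb_rec of_rat_diff of_rat_mult)
    also have "\<dots> = 2 * (2 * Re w * Re (w ^ Suc m) - Re (w ^ m))"
      unfolding IH assms(2) by (simp only: right_diff_distrib mult.assoc mult.left_commute)
    also have "\<dots> = 2 * Re (w ^ n)"
      unfolding Re_n ..
    finally show ?thesis .
  qed (use assms in \<open>simp_all add: cheb_0 cheb_1\<close>)
qed

section \<open>Roots of unity among the Gaussian rationals\<close>

definition gaussian_rats :: "complex set" where
  "gaussian_rats = {z. Re z \<in> \<rat> \<and> Im z \<in> \<rat>}"

lemma gaussian_rats_mult [intro]:
  "z \<in> gaussian_rats \<Longrightarrow> w \<in> gaussian_rats \<Longrightarrow> z * w \<in> gaussian_rats"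
  by (simp add: gaussian_rats_def)

lemma gaussian_rats_cnj [intro]: "z \<in> gaussian_rats \<Longrightarrow> cnj z \<in> gaussian_rats"
  by (simp add: gaussian_rats_def)

lemma gaussian_rats_inverse [intro]: "z \<in> gaussian_rats \<Longrightarrow> inverse z \<in> gaussian_rats"
  by (simp add: gaussian_rats_def)

lemma gaussian_rats_divide [intro]:
  "z \<in> gaussian_rats \<Longrightarrow> w \<in> gaussian_rats \<Longrightarrow> z / w \<in> gaussian_rats"
  unfolding divide_inverse by blast

lemma gaussian_rats_1 [simp]: "1 \<in> gaussian_rats" and gaussian_rats_i [simp]: "\<i> \<in> gaussian_rats"
  by (simp_all add: gaussian_rats_def)

lemma gaussian_rats_power [intro]: "z \<in> gaussian_rats \<Longrightarrow> z ^ n \<in> gaussian_rats"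
  by (induction n) auto

lemma gaussian_rats_power_int [intro]: "z \<in> gaussian_rats \<Longrightarrow> z powi k \<in> gaussian_rats"
  by (auto simp: power_int_def)

lemma gaussian_rats_rational:
  assumes "z \<in> gaussian_rats" "cnj z = z"
  obtains c where "c \<in> \<rat>" "z = of_real c"
  using assms by (force simp: gaussian_rats_def complex_eq_iff)

text \<open>If \<open>z ^ n = 1\<close>, then \<open>cheb n (2 * Re z) = 2\<close>, so the rational number \<open>2 * Re z\<close> is an integer of absolute value at most 2.
  The values \<open>1\<close> and \<open>-1\<close> would make \<open>2 * Im z\<close> a rational square root of 3.\<close>

lemma gaussian_root_of_unity:
  assumes "z \<in> gaussian_rats" "z ^ n = 1" "n > 0"
  shows "z \<in> {1, -1, \<i>, -\<i>}"
proof -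
  have nz: "norm z = 1"
    using assms(2,3) power_eq_1_iff by blast
  then have nn: "(Re z)\<^sup>2 + (Im z)\<^sup>2 = 1" by (simp add: cmod_def)
  obtain x where x: "Re z = of_rat x" using assms(1) by (auto simp: gaussian_rats_def elim: Rats_cases)
  obtain y where y: "Im z = of_rat y" using assms(1) by (auto simp: gaussian_rats_def elim: Rats_cases)
  have "real_of_rat (x\<^sup>2 + y\<^sup>2) = real_of_rat 1"
    using nn by (simp add: x y of_rat_add of_rat_power)
  then have xy: "x\<^sup>2 + y\<^sup>2 = 1" by (simp only: of_rat_eq_iff)
  have "real_of_rat (cheb n (2 * x)) = 2 * Re (z ^ n)"
    using nz by (intro cheb_sum_conj) (simp_all add: x of_rat_mult)
  also have "\<dots> = real_of_rat 2" by (simp add: assms(2))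
  finally have "cheb n (2 * x) = 2" by (simp only: of_rat_eq_iff)
  then have "cheb n (2 * x) \<in> \<int>" by (simp only: Ints_numeral)
  then have "2 * x \<in> \<int>" using assms(3) by (rule cheb_Ints_imp_Ints)
  then obtain k where k: "2 * x = of_int k" by (auto elim: Ints_cases)
  have dbl: "(2 * x)\<^sup>2 = 4 * x\<^sup>2" "(2 * y)\<^sup>2 = 4 * y\<^sup>2"
    by (simp_all add: power_mult_distrib)
  have "(2 * x)\<^sup>2 \<le> 4" using xy zero_le_power2[of y] unfolding dbl by linarith
  then have "\<bar>2 * x\<bar> \<le> 2" using abs_le_square_iff[of "2 * x" 2] by simp
  then have "\<bar>k\<bar> \<le> 2" unfolding k by linarith
  then consider "k = 0" | "\<bar>k\<bar> = 1" | "\<bar>k\<bar> = 2" by linarith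
  then show ?thesis
  proof cases
    case 1
    then have "x = 0" using k by simp
    moreover from this have "y = 1 \<or> y = -1" using xy by (simp add: power2_eq_1_iff)
    ultimately show ?thesis by (auto simp: complex_eq_iff x y)
  next
    case 2
    then have "k = 1 \<or> k = -1" by linarith
    then have "(of_int k :: rat)\<^sup>2 = 1" by (elim disjE) simp_all
    then have "(2 * x)\<^sup>2 = 1" unfolding k .
    then have "(2 * y)\<^sup>2 = 3" using xy unfolding dbl by linarith
    then show ?thesis using rat_square_neq_3 by blast
  next
    case 3
    then have "k = 2 \<or> k = -2" by linarith
    then have "of_int k = (2 :: rat) \<or> of_int k = (-2 :: rat)" by (elim disjE) simp_all
    then have x1: "x = 1 \<or> x = -1" using k by linarith
    then have "x\<^sup>2 = 1" by (elim disjE) simp_all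
    then have "y = 0" using xy by simp
    with x1 show ?thesis by (auto simp: complex_eq_iff x y)
  qed
qed

section \<open>Torsion modulo powers of a point of the unit circle\<close>

lemma fourth_root_gaussian:
  assumes "z \<in> gaussian_rats" "z ^ n = 1" "n > 0"
  shows "z ^ 4 = 1"
  using gaussian_root_of_unity[OF assms] by (auto simp: power4_eq_xxxx)

text \<open>The torsion of the rational points of the unit circle modulo powers of \<open>D\<close>: it is generated by \<open>D\<close> and the four roots of
  unity.  Dividing \<open>n\<close> and \<open>k\<close> by their greatest common divisor changes \<open>u ^ n = D powi k\<close> by a root of unity only.  For
  coprime exponents, Bezout's identity then writes \<open>D\<close>, up to a root of unity, as an \<open>n'\<close>-th power, which the two
  hypotheses forbid unless \<open>n' = 1\<close>.  For odd \<open>r\<close> a fourth root of unity is the \<open>r\<close>-th power of a fourth root of unity and can be absorbed into the base; for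
  squares this fails, which is why \<open>nonsquare\<close> speaks of the multiples of \<open>D\<close> by all four of them.\<close>

lemma torsion_modulo_nonpower:
  fixes D u :: complex
  assumes D: "D \<in> gaussian_rats" "norm D = 1" and u: "u \<in> gaussian_rats" "norm u = 1"
    and n: "n > 0" and un: "u ^ n = D powi k"
    and nonpower: "\<And>r w. r \<ge> 2 \<Longrightarrow> w \<in> gaussian_rats \<Longrightarrow> norm w = 1 \<Longrightarrow> w ^ r \<noteq> D"
    and nonsquare: "\<And>w \<epsilon>. w \<in> gaussian_rats \<Longrightarrow> norm w = 1 \<Longrightarrow> \<epsilon> \<in> gaussian_rats \<Longrightarrow>
      \<epsilon> ^ 4 = 1 \<Longrightarrow> w\<^sup>2 \<noteq> \<epsilon> * D"
  obtains \<epsilon> j where "\<epsilon> \<in> gaussian_rats" "\<epsilon> ^ 4 = 1" "u = \<epsilon> * D powi j"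
proof -
  have nz: "D \<noteq> 0" "u \<noteq> 0" using D(2) u(2) by auto
  define g where "g = gcd (int n) k"
  have "g > 0" using n by (simp add: g_def)
  then obtain n' k' where nk: "int n = n' * g" "k = k' * g" "coprime n' k'"
    using gcd_coprime_exists[of "int n" k] unfolding g_def by auto
  have n': "n' > 0" using nk(1) n \<open>g > 0\<close> by (metis of_nat_0_less_iff zero_less_mult_pos2)
  define v where "v = u powi n' * D powi (- k')"
  have vg: "v \<in> gaussian_rats" using D(1) u(1) unfolding v_def by blast
  \<comment> \<open>By construction \<open>v\<close> is a \<open>g\<close>-torsion element, hence a root of unity.\<close>
  have "v powi g = u powi int n * D powi (- k)"
    by (simp add: v_def power_int_mult_distrib nk flip: power_int_mult)
  also have "\<dots> = 1"
    using un nz by (simp add: power_int_minus)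
  finally have "v ^ nat g = 1" using \<open>g > 0\<close> by (simp add: power_int_def)
  then have v4: "v ^ 4 = 1" using fourth_root_gaussian[OF vg] \<open>g > 0\<close> by auto
  have uD: "u powi n' = v * D powi k'"
    using nz by (simp add: v_def power_int_minus)
  obtain x y where "x * n' + y * k' = gcd n' k'" using bezout_int by blast
  with nk(3) have xy: "x * n' + y * k' = 1" by simp
  define \<delta> where "\<delta> = v powi y"
  define w where "w = D powi x * u powi y"
  have "\<delta> ^ 4 = (v ^ 4) powi y"
    unfolding \<delta>_def power_int_power power_int_power' by (simp add: mult.commute)
  then have \<delta>: "\<delta> \<in> gaussian_rats" "\<delta> ^ 4 = 1"
    using vg v4 unfolding \<delta>_def by auto
  have w: "w \<in> gaussian_rats" "norm w = 1"
    using D u unfolding w_def by (auto simp: norm_mult norm_power_int)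
  define m where "m = nat n'"
  have m: "int m = n'" "m > 0" using n' by (simp_all add: m_def)
  have "w ^ m = w powi n'" using m by (metis power_int_of_nat)
  also have "\<dots> = D powi (x * n') * (u powi n') powi y"
    unfolding w_def power_int_mult_distrib by (simp add: mult.commute flip: power_int_mult)
  also have "\<dots> = \<delta> * D powi (x * n' + y * k')"
    unfolding uD \<delta>_def power_int_mult_distrib using nz
    by (simp add: power_int_add mult.commute flip: power_int_mult)
  finally have wm: "w ^ m = \<delta> * D" by (simp add: xy)
  consider "m = 1" | l where "m = 2 * l" | "odd m" "m \<ge> 2"
  proof (cases "m = 1")
    case False
    with m(2) have "m \<ge> 2" by linarith
    then show ?thesis using that by (cases "even m") (auto elim: evenE)
  qed (use that in simp)
  then show ?thesis
  proof cases
    case 1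
    then have "u = v * D powi k'" using uD m by simp
    then show ?thesis using vg v4 that by blast
  next
    case 2
    have "(w ^ l)\<^sup>2 = w ^ m" unfolding 2 by (simp add: mult.commute flip: power_mult)
    moreover have "w ^ l \<in> gaussian_rats" "norm (w ^ l) = 1"
      using w by (auto simp: norm_power)
    moreover note wm
    ultimately show ?thesis using nonsquare \<delta> by metis
  next
    case 3
    then obtain l where l: "m = 2 * l + 1" by (auto elim: oddE)
    \<comment> \<open>For odd \<open>m\<close> we have \<open>m * m = 1\<close> modulo 4, so the exponent \<open>3 * m\<close> makes the \<open>m\<close>-th power cancel \<open>\<delta>\<close>.\<close>
    have "(w * \<delta> ^ (3 * m)) ^ m = \<delta> ^ (3 * m * m + 1) * D"
      by (simp add: power_mult_distrib wm flip: power_mult)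
    also have "3 * m * m + 1 = 4 * (3 * l\<^sup>2 + 3 * l + 1)"
      by (simp add: l power2_eq_square algebra_simps)
    also have "\<delta> ^ \<dots> = 1" unfolding power_mult \<delta>(2) by simp
    finally have "(w * \<delta> ^ (3 * m)) ^ m = D" by simp
    moreover have "norm \<delta> = 1" using \<delta>(2) power_eq_1_iff[of \<delta> 4] by simp
    then have "norm (w * \<delta> ^ (3 * m)) = 1" using w by (simp add: norm_mult norm_power)
    moreover have "w * \<delta> ^ (3 * m) \<in> gaussian_rats" using w \<delta> by blast
    ultimately show ?thesis using nonpower 3 by blast
  qed
qed

lemma r_primitive_nonpower:
  assumes "r_primitive r s" "real_of_rat s = 2 * Re z" "w \<in> gaussian_rats" "norm w = 1"
  shows "w ^ r \<noteq> z"
proof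
  assume z: "w ^ r = z"
  obtain x where x: "Re w = of_rat x" using assms(3) by (auto simp: gaussian_rats_def elim: Rats_cases)
  have "real_of_rat (cheb r (2 * x)) = 2 * Re (w ^ r)"
    using assms(4) by (intro cheb_sum_conj) (simp_all add: x of_rat_mult)
  then have "real_of_rat (cheb r (2 * x)) = real_of_rat s" using assms(2) z by simp
  then have "s = cheb r (2 * x)" by simp
  with assms(1) show False by (auto simp: r_primitive_def)
qed

lemma cnj_eq_inverse: "norm z = 1 \<Longrightarrow> cnj z = inverse z" for z :: complex
proof -
  assume "norm z = 1"
  then have "z * cnj z = 1" using complex_norm_square[of z] by simp
  then show "cnj z = inverse z" by (metis inverse_unique)
qed

text \<open>The injective half of Hilbert 90 for the Gaussian rationals: \<open>z / cnj z\<close> determines \<open>z\<close> up to a rational factor,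
  because a quotient with equal ratios is fixed by conjugation.  On the circle \<open>D / cnj D\<close> is the square of \<open>D\<close>, which is
  why the exponent \<open>2 * j\<close> becomes \<open>j\<close>.\<close>

lemma gaussian_hilbert_90:
  assumes "z \<in> gaussian_rats" "b \<in> gaussian_rats" "D \<in> gaussian_rats"
    and "z \<noteq> 0" "b \<noteq> 0" "norm D = 1"
    and eq: "z / cnj z = b / cnj b * D powi (2 * j)"
  obtains c where "c \<in> \<rat>" "c \<noteq> 0" "z = of_real c * D powi j * b"
proof -
  have D0: "D \<noteq> 0" using assms(6) by auto
  have cD: "cnj D = inverse D" using assms(6) by (rule cnj_eq_inverse)
  define s where "s = z / (D powi j * b)"
  have "cnj s = cnj z / (cnj b / D powi j)"
    using D0 by (simp add: s_def cD power_int_inverse divide_inverse mult.commute)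
  also have "\<dots> = z / (D powi j * b)"
  proof -
    have "D powi (2 * j) = D powi j * D powi j"
      unfolding mult_2 by (rule power_int_add) (simp add: D0)
    then show ?thesis using assms(4,5) D0 eq by (simp add: field_simps)
  qed
  finally have "cnj s = s" by (simp add: s_def)
  moreover have "s \<in> gaussian_rats" unfolding s_def using assms by blast
  ultimately obtain c where c: "c \<in> \<rat>" "s = of_real c" by (metis gaussian_rats_rational)
  have "z = s * D powi j * b" using assms(5) D0 by (simp add: s_def)
  with c assms(4) show ?thesis by (intro that[of c]) auto
qed

section \<open>The Laxton group of a circular parameter inside the complex numbers\<close>

text \<open>For circular \<open>t\<close> other than \<open>2\<close> and \<open>-2\<close> the characteristic polynomial of \<open>D\<^sub>t\<close> has discriminant \<open>t\<^sup>2 - 4 = - a\<^sup>2\<close>, so the ring of matrices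
  commuting with \<open>D\<^sub>t\<close> is the field of Gaussian rationals.  The locale fixes the embedding into the complex numbers that sends
  \<open>D\<^sub>t\<close> to its eigenvalue \<open>(t + a \<i>) / 2\<close>, a point of the unit circle.\<close>

locale circular_parameter =
  fixes t a :: rat
  assumes circle: "t\<^sup>2 + a\<^sup>2 = 4" and a_nonzero: "a \<noteq> 0"
begin

definition D :: complex where
  "D = Complex (of_rat t / 2) (of_rat a / 2)"

text \<open>The matrix \<open>[x\<^sub>0 x\<^sub>1]\<close> equals \<open>x\<^sub>0 D\<^sub>t + (x\<^sub>1 - t x\<^sub>0) I\<close>, and its coordinates are the entries of the second row.\<close>

definition to_complex :: "rat^2^2 \<Rightarrow> complex" where
  "to_complex A = Complex (of_rat (A $ 2 $ 2 - t * A $ 2 $ 1 / 2)) (of_rat (a * A $ 2 $ 1 / 2))"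

lemma D_gaussian: "D \<in> gaussian_rats"
  by (simp add: D_def gaussian_rats_def)

lemma norm_D: "norm D = 1"
proof -
  have "(real_of_rat t)\<^sup>2 + (real_of_rat a)\<^sup>2 = real_of_rat (t\<^sup>2 + a\<^sup>2)"
    by (simp add: of_rat_add of_rat_power)
  then show ?thesis
    by (simp add: D_def cmod_def circle power_divide flip: add_divide_distrib)
qed

lemma D_nonzero: "D \<noteq> 0"
  using norm_D by auto

lemma cnj_D: "cnj D = inverse D"
  using norm_D by (rule cnj_eq_inverse)

lemma to_complex_elt:
  "to_complex (elt t x0 x1) = Complex (of_rat (x1 - t * x0 / 2)) (of_rat (a * x0 / 2))"
  by (simp add: to_complex_def elt_def)

lemma to_complex_gaussian [simp]: "to_complex A \<in> gaussian_rats"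
  by (simp add: to_complex_def gaussian_rats_def)

lemma to_complex_mult:
  assumes "A \<in> carrier (ring_R t)" "B \<in> carrier (ring_R t)"
  shows "to_complex (A ** B) = to_complex A * to_complex B"
proof -
  obtain x0 x1 y0 y1 where AB: "A = elt t x0 x1" "B = elt t y0 y1"
    using assms by (auto simp: carrier_R)
  \<comment> \<open>The only place where multiplicativity uses the relation between \<open>t\<close> and \<open>a\<close>.\<close>
  have a2: "a * a = 4 - t * t" using circle by (simp add: power2_eq_square algebra_simps)
  have prod: "elt t x0 x1 ** elt t y0 y1 = elt t (x0 * (y1 - t * y0) + x1 * y0) (x1 * y1 - x0 * y0)"
    by (simp add: mat2_simps elt_def algebra_simps)
  have aa: "(a * x0 / 2) * (a * y0 / 2) = (a * a) * (x0 * y0) / 4"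
    by simp
  have re: "(x1 * y1 - x0 * y0) - t * (x0 * (y1 - t * y0) + x1 * y0) / 2
      = (x1 - t * x0 / 2) * (y1 - t * y0 / 2) - (a * x0 / 2) * (a * y0 / 2)"
    unfolding aa a2 by (simp add: field_simps)
  have im: "a * (x0 * (y1 - t * y0) + x1 * y0) / 2
      = (x1 - t * x0 / 2) * (a * y0 / 2) + (a * x0 / 2) * (y1 - t * y0 / 2)"
    by (simp add: field_simps)
  show ?thesis
    unfolding AB prod to_complex_elt re im
    by (simp add: complex_eq_iff of_rat_add of_rat_mult of_rat_diff of_rat_divide)
qed

lemma to_complex_inj:
  assumes "A \<in> carrier (ring_R t)" "B \<in> carrier (ring_R t)" "to_complex A = to_complex B"
  shows "A = B"
  using assms a_nonzero by (auto simp: carrier_R to_complex_elt)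

lemma to_complex_one: "to_complex (mat 1) = 1"
  by (simp add: to_complex_elt complex_eq_iff flip: elt_one[of t])

lemma to_complex_mat: "to_complex (mat c) = of_real (of_rat c)"
  by (simp add: to_complex_def complex_eq_iff mat_def)

lemma to_complex_D: "to_complex (mat_D t) = D"
  by (simp add: to_complex_def complex_eq_iff mat_D_def D_def of_rat_divide)

text \<open>Both sides are the norm form of the quadratic field; hence the matrices of nonzero determinant are exactly those with nonzero
  image.\<close>

lemma det_eq_norm: "A \<in> carrier (ring_R t) \<Longrightarrow> real_of_rat (det A) = (norm (to_complex A))\<^sup>2"
proof -
  assume "A \<in> carrier (ring_R t)"
  then obtain x0 x1 where A: "A = elt t x0 x1" by (auto simp: carrier_R)
  have "det A = (x1 - t * x0) * x1 + x0\<^sup>2"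
    by (simp add: A det_2 elt_def power2_eq_square)
  also have "\<dots> = (x1 - t * x0 / 2)\<^sup>2 + (4 - t\<^sup>2) * x0\<^sup>2 / 4"
    by (simp add: field_simps power2_eq_square)
  also have "4 - t\<^sup>2 = a\<^sup>2" using circle by linarith
  also have "(x1 - t * x0 / 2)\<^sup>2 + a\<^sup>2 * x0\<^sup>2 / 4 = (x1 - t * x0 / 2)\<^sup>2 + (a * x0 / 2)\<^sup>2"
    by (simp add: power_mult_distrib power_divide)
  finally show ?thesis
    by (simp add: A to_complex_elt cmod_def of_rat_add of_rat_power)
qed

lemma carrier_R_nonsing:
  "A \<in> carrier (R_nonsing t) \<longleftrightarrow> A \<in> carrier (ring_R t) \<and> to_complex A \<noteq> 0"
  using det_eq_norm[of A] by (auto simp: R_nonsing_def)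

lemma elt_in_R_nonsing:
  assumes "to_complex (elt t x0 x1) \<noteq> 0"
  shows "elt t x0 x1 \<in> carrier (R_nonsing t)"
  using assms by (auto simp: carrier_R_nonsing carrier_R)

lemma mat_in_R_nonsing: "mat c \<in> carrier (R_nonsing t) \<longleftrightarrow> c \<noteq> 0"
  by (simp add: carrier_R_nonsing to_complex_mat) (simp add: ring_R_def mat2_simps)

lemma mat_D_in_R_nonsing: "mat_D t \<in> carrier (R_nonsing t)"
  by (simp add: carrier_R_nonsing to_complex_D D_nonzero) (simp add: ring_R_def)

sublocale R: comm_group "R_nonsing t" by (rule comm_group_R_nonsing)
sublocale L: comm_group "sequence_group t" by (rule comm_group_sequence_group)
sublocale Q: comm_group "laxton_group t" by (rule comm_group_laxton_group)

lemma to_complex_m: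
  assumes "A \<in> carrier (R_nonsing t)" "B \<in> carrier (R_nonsing t)"
  shows "to_complex (A \<otimes>\<^bsub>R_nonsing t\<^esub> B) = to_complex A * to_complex B"
  using assms by (simp add: carrier_R_nonsing to_complex_mult R_nonsing_def)

lemma to_complex_R_one: "to_complex \<one>\<^bsub>R_nonsing t\<^esub> = 1"
  by (simp add: R_nonsing_def to_complex_one)

lemma to_complex_nat_pow:
  assumes "A \<in> carrier (R_nonsing t)"
  shows "to_complex (A [^]\<^bsub>R_nonsing t\<^esub> (n :: nat)) = to_complex A ^ n"
  using assms by (induction n) (simp_all add: to_complex_m to_complex_R_one)

lemma to_complex_inv:
  assumes "A \<in> carrier (R_nonsing t)"
  shows "to_complex (inv\<^bsub>R_nonsing t\<^esub> A) = inverse (to_complex A)"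
proof -
  have "to_complex A * to_complex (inv\<^bsub>R_nonsing t\<^esub> A) = 1"
    using to_complex_m[OF assms R.inv_closed[OF assms]] R.r_inv[OF assms] to_complex_R_one by simp
  then show ?thesis by (metis inverse_unique)
qed

lemma to_complex_int_pow:
  assumes "A \<in> carrier (R_nonsing t)"
  shows "to_complex (A [^]\<^bsub>R_nonsing t\<^esub> (k :: int)) = to_complex A powi k"
proof (cases "k < 0")
  case True
  then have "A [^]\<^bsub>R_nonsing t\<^esub> k = inv\<^bsub>R_nonsing t\<^esub> (A [^]\<^bsub>R_nonsing t\<^esub> nat (- k))"
    by (simp only: int_pow_def2 if_True)
  then have "to_complex (A [^]\<^bsub>R_nonsing t\<^esub> k) = inverse (to_complex A ^ nat (- k))"
    by (simp only: to_complex_inv[OF R.nat_pow_closed[OF assms]] to_complex_nat_pow[OF assms])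
  then show ?thesis using True by (simp add: power_int_def power_inverse)
next
  case False
  then show ?thesis
    by (simp only: int_pow_def2 power_int_def if_False to_complex_nat_pow[OF assms]) simp
qed

lemma L_class_hom: "L_class t \<in> hom (R_nonsing t) (sequence_group t)"
proof -
  have "L_class t = (\<lambda>A. scalars #>\<^bsub>R_nonsing t\<^esub> A)"
    by (rule ext) (rule L_class_def)
  then show ?thesis
    unfolding sequence_group_def
    using normal.r_coset_hom_Mod[OF R.subgroup_imp_normal[OF subgroup_scalars]] by simp
qed

lemma G_class_hom: "G_class t \<in> hom (R_nonsing t) (laxton_group t)"
proof -
  have "(\<lambda>X. D_subgroup t #>\<^bsub>sequence_group t\<^esub> X) \<in> hom (sequence_group t) (laxton_group t)"
    using normal.r_coset_hom_Mod[OF L.subgroup_imp_normal[OF subgroup_D_subgroup]]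
    unfolding laxton_group_def .
  from hom_compose[OF L_class_hom this]
  have "(\<lambda>A. D_subgroup t #>\<^bsub>sequence_group t\<^esub> L_class t A) \<in> hom (R_nonsing t) (laxton_group t)"
    unfolding comp_def .
  moreover have "G_class t = (\<lambda>A. D_subgroup t #>\<^bsub>sequence_group t\<^esub> L_class t A)"
    by (rule ext) (rule G_class_def)
  ultimately show ?thesis by (rule ssubst[rotated])
qed

sublocale q: group_hom "R_nonsing t" "laxton_group t" "G_class t"
  using G_class_hom by (simp add: group_hom_def group_hom_axioms_def)

lemma carrier_laxton: "carrier (laxton_group t) = G_class t ` carrier (R_nonsing t)"
  by (simp add: laxton_group_def sequence_group_def carrier_FactGroup image_image G_class_def L_class_def)

lemma L_class_eq_iff:
  assumes "A \<in> carrier (R_nonsing t)" "B \<in> carrier (R_nonsing t)"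
  shows "L_class t A = L_class t B \<longleftrightarrow> (\<exists>c. c \<noteq> 0 \<and> to_complex A = of_real (of_rat c) * to_complex B)"
proof
  assume "L_class t A = L_class t B"
  then have "A \<in> L_class t B"
    using R.rcos_self[OF assms(1) subgroup_scalars] by (simp add: L_class_def)
  then obtain c where c: "c \<noteq> 0" "A = mat c \<otimes>\<^bsub>R_nonsing t\<^esub> B"
    by (auto simp: L_class_def r_coset_def scalars_def)
  then show "\<exists>c. c \<noteq> 0 \<and> to_complex A = of_real (of_rat c) * to_complex B"
    using assms mat_in_R_nonsing by (auto simp: to_complex_m to_complex_mat)
next
  assume "\<exists>c. c \<noteq> 0 \<and> to_complex A = of_real (of_rat c) * to_complex B"
  then obtain c where c: "c \<noteq> 0" "to_complex A = of_real (of_rat c) * to_complex B" by blast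
  have mc: "mat c \<in> carrier (R_nonsing t)" using c(1) by (simp add: mat_in_R_nonsing)
  have mB: "mat c \<otimes>\<^bsub>R_nonsing t\<^esub> B \<in> carrier (R_nonsing t)"
    using R.m_closed[OF mc assms(2)] .
  have "A = mat c \<otimes>\<^bsub>R_nonsing t\<^esub> B"
  proof (rule to_complex_inj)
    show "to_complex A = to_complex (mat c \<otimes>\<^bsub>R_nonsing t\<^esub> B)"
      unfolding to_complex_m[OF mc assms(2)] to_complex_mat by (rule c(2))
  qed (use assms(1) mB in \<open>simp_all only: carrier_R_nonsing\<close>)
  moreover have "mat c \<in> scalars" using c(1) by (auto simp: scalars_def)
  ultimately have "A \<in> scalars #>\<^bsub>R_nonsing t\<^esub> B"
    unfolding r_coset_def by blast
  then show "L_class t A = L_class t B"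
    using R.repr_independence[OF _ assms(2) subgroup_scalars] by (simp add: L_class_def)
qed

text \<open>Unfolds the two quotients that define the Laxton group: scalars become nonzero rationals, and the cyclic subgroup
  consists of the integer powers of \<open>D\<close>.\<close>

lemma G_class_eq_one_iff:
  assumes "A \<in> carrier (R_nonsing t)"
  shows "G_class t A = \<one>\<^bsub>laxton_group t\<^esub> \<longleftrightarrow>
    (\<exists>c k. c \<noteq> 0 \<and> to_complex A = of_real (of_rat c) * D powi k)"
proof -
  have LA: "L_class t A \<in> carrier (sequence_group t)" "L_class t (mat_D t) \<in> carrier (sequence_group t)"
    using assms mat_D_in_R_nonsing by (simp_all add: L_class_closed)
  have "G_class t A = \<one>\<^bsub>laxton_group t\<^esub> \<longleftrightarrow> L_class t A \<in> D_subgroup t"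
    using L.coset_join1[OF _ LA(1) subgroup_D_subgroup] L.coset_join2[OF LA(1) subgroup_D_subgroup]
    by (auto simp: G_class_def laxton_group_def)
  also have "\<dots> \<longleftrightarrow> (\<exists>k::int. L_class t A = L_class t (mat_D t) [^]\<^bsub>sequence_group t\<^esub> k)"
    unfolding D_subgroup_def L.generate_pow[OF LA(2)] by blast
  also have "\<dots> \<longleftrightarrow> (\<exists>k. \<exists>c. c \<noteq> 0 \<and> to_complex A = of_real (of_rat c) * D powi k)"
  proof (intro ex_cong1)
    fix k :: int
    have "L_class t (mat_D t) [^]\<^bsub>sequence_group t\<^esub> k = L_class t (mat_D t [^]\<^bsub>R_nonsing t\<^esub> k)"
      by (rule hom_int_pow[OF L_class_hom mat_D_in_R_nonsing R.is_group L.is_group, symmetric])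
    then show "L_class t A = L_class t (mat_D t) [^]\<^bsub>sequence_group t\<^esub> k \<longleftrightarrow>
        (\<exists>c. c \<noteq> 0 \<and> to_complex A = of_real (of_rat c) * D powi k)"
      using L_class_eq_iff[OF assms R.int_pow_closed[OF mat_D_in_R_nonsing, of k]]
        to_complex_int_pow[OF mat_D_in_R_nonsing, of k] to_complex_D
      by simp
  qed
  also have "\<dots> \<longleftrightarrow> (\<exists>c k. c \<noteq> 0 \<and> to_complex A = of_real (of_rat c) * D powi k)"
    by blast
  finally show ?thesis .
qed

text \<open>The Hilbert 90 map.  Its kernel is the group of scalars, so it identifies the sequence group with a group of rational points of
  the unit circle, on which all questions about the Laxton group become questions about powers of \<open>D\<close>.\<close>

definition unit_ratio :: "rat^2^2 \<Rightarrow> complex" where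
  "unit_ratio A = to_complex A / cnj (to_complex A)"

lemma unit_ratio_gaussian [simp]: "unit_ratio A \<in> gaussian_rats"
  unfolding unit_ratio_def by (intro gaussian_rats_divide gaussian_rats_cnj to_complex_gaussian)

lemma norm_unit_ratio: "A \<in> carrier (R_nonsing t) \<Longrightarrow> norm (unit_ratio A) = 1"
  by (simp add: unit_ratio_def norm_divide carrier_R_nonsing)

lemma unit_ratio_m:
  assumes "A \<in> carrier (R_nonsing t)" "B \<in> carrier (R_nonsing t)"
  shows "unit_ratio (A \<otimes>\<^bsub>R_nonsing t\<^esub> B) = unit_ratio A * unit_ratio B"
  using assms by (simp add: unit_ratio_def to_complex_m)

lemma unit_ratio_inv:
  assumes "A \<in> carrier (R_nonsing t)"
  shows "unit_ratio (inv\<^bsub>R_nonsing t\<^esub> A) = inverse (unit_ratio A)"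
  using assms by (simp add: unit_ratio_def to_complex_inv divide_inverse)

lemma unit_ratio_nat_pow:
  assumes "A \<in> carrier (R_nonsing t)"
  shows "unit_ratio (A [^]\<^bsub>R_nonsing t\<^esub> (n :: nat)) = unit_ratio A ^ n"
  using assms by (simp add: unit_ratio_def to_complex_nat_pow power_divide)

lemma D_powi_double: "D powi (2 * k) = D powi k * D powi k"
  unfolding mult_2 by (rule power_int_add) (simp add: D_nonzero)

lemma G_class_eq_one_iff_unit_ratio:
  assumes "A \<in> carrier (R_nonsing t)"
  shows "G_class t A = \<one>\<^bsub>laxton_group t\<^esub> \<longleftrightarrow> (\<exists>k. unit_ratio A = D powi (2 * k))"
proof
  assume "G_class t A = \<one>\<^bsub>laxton_group t\<^esub>"
  then obtain c k where "c \<noteq> 0" "to_complex A = of_real (of_rat c) * D powi k"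
    using assms by (auto simp: G_class_eq_one_iff)
  then have "unit_ratio A = D powi (2 * k)"
    unfolding D_powi_double by (simp add: unit_ratio_def cnj_D power_int_inverse divide_inverse D_nonzero)
  then show "\<exists>k. unit_ratio A = D powi (2 * k)" ..
next
  assume "\<exists>k. unit_ratio A = D powi (2 * k)"
  then obtain k where k: "to_complex A / cnj (to_complex A) = 1 / cnj 1 * D powi (2 * k)"
    by (auto simp: unit_ratio_def)
  obtain c where "c \<in> \<rat>" "c \<noteq> 0" "to_complex A = of_real c * D powi k * 1"
    using gaussian_hilbert_90[OF _ _ D_gaussian _ _ norm_D k] assms
    by (auto simp: carrier_R_nonsing)
  then show "G_class t A = \<one>\<^bsub>laxton_group t\<^esub>"
    unfolding G_class_eq_one_iff[OF assms] by (auto elim!: Rats_cases)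
qed

text \<open>Equality in the Laxton group, read off from the circle.  Only even powers of \<open>D\<close> appear, because \<open>D / cnj D\<close> is the
  square of \<open>D\<close>; this is where the factor of order 2 in the torsion comes from.\<close>

lemma G_class_eq_iff:
  assumes "A \<in> carrier (R_nonsing t)" "B \<in> carrier (R_nonsing t)"
  shows "G_class t A = G_class t B \<longleftrightarrow> (\<exists>k. unit_ratio A = unit_ratio B * D powi (2 * k))"
proof -
  let ?X = "A \<otimes>\<^bsub>R_nonsing t\<^esub> inv\<^bsub>R_nonsing t\<^esub> B"
  have X: "?X \<in> carrier (R_nonsing t)" using assms by simp
  have 0: "unit_ratio B \<noteq> 0" using norm_unit_ratio[OF assms(2)] by auto
  have "G_class t A = G_class t B \<longleftrightarrow> G_class t ?X = \<one>\<^bsub>laxton_group t\<^esub>"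
    using assms by (simp add: Q.inv_solve_right')
  also have "\<dots> \<longleftrightarrow> (\<exists>k. unit_ratio A = unit_ratio B * D powi (2 * k))"
    unfolding G_class_eq_one_iff_unit_ratio[OF X]
    using assms 0 by (simp add: unit_ratio_m unit_ratio_inv field_simps)
  finally show ?thesis .
qed

lemma unit_ratio_one: "unit_ratio (mat 1) = 1"
  by (simp add: unit_ratio_def to_complex_one)

text \<open>Up to the factor \<open>a\<close>, the matrices \<open>C\<close>, \<open>G\<close>, \<open>H\<close> are \<open>\<i>\<close>, \<open>1 + \<i>\<close>, \<open>\<i> - 1\<close>, so their ratios are the nontrivial
  fourth roots of unity.  The matrix \<open>W\<close> is \<open>1 + 1 / D\<close>; its ratio is an odd power of \<open>D\<close>.\<close>

lemma
  shows C_in_R: "elt t 2 t \<in> carrier (R_nonsing t)" and unit_ratio_C: "unit_ratio (elt t 2 t) = -1"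
    and G_in_R: "elt t 2 (t + a) \<in> carrier (R_nonsing t)" and unit_ratio_G: "unit_ratio (elt t 2 (t + a)) = \<i>"
    and H_in_R: "elt t 2 (t - a) \<in> carrier (R_nonsing t)" and unit_ratio_H: "unit_ratio (elt t 2 (t - a)) = -\<i>"
    and W_in_R: "elt t (-1) 1 \<in> carrier (R_nonsing t)" and unit_ratio_W: "unit_ratio (elt t (-1) 1) = inverse D"
proof -
  have C: "to_complex (elt t 2 t) = of_real (of_rat a) * \<i>"
    and G: "to_complex (elt t 2 (t + a)) = of_real (of_rat a) * (1 + \<i>)"
    and H: "to_complex (elt t 2 (t - a)) = of_real (of_rat a) * (\<i> - 1)"
    and W: "to_complex (elt t (-1) 1) = 1 + inverse D"
    unfolding cnj_D[symmetric]
    by (simp_all add: to_complex_elt complex_eq_iff D_def of_rat_add of_rat_minus of_rat_divide)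
  have nz: "1 + \<i> \<noteq> 0" "\<i> - 1 \<noteq> 0" "1 - \<i> \<noteq> 0" "- \<i> - 1 \<noteq> 0"
    by (simp_all add: complex_eq_iff)
  have "Im (1 + inverse D) \<noteq> 0" unfolding cnj_D[symmetric] using a_nonzero by (simp add: D_def)
  then have W0: "1 + inverse D \<noteq> 0" by (metis zero_complex.sel(2))
  show "elt t 2 t \<in> carrier (R_nonsing t)" "elt t 2 (t + a) \<in> carrier (R_nonsing t)"
    "elt t 2 (t - a) \<in> carrier (R_nonsing t)" "elt t (-1) 1 \<in> carrier (R_nonsing t)"
    using a_nonzero nz W0 by (auto intro!: elt_in_R_nonsing simp del: minus_complex.sel simp: C G H W)
  have "1 + \<i> = \<i> * (1 - \<i>)" "\<i> - 1 = - \<i> * (- \<i> - 1)"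
    by (simp_all add: complex_eq_iff)
  then have div: "(1 + \<i>) / (1 - \<i>) = \<i>" "(\<i> - 1) / (- \<i> - 1) = - \<i>"
    using nz by (simp_all add: divide_eq_eq)
  show "unit_ratio (elt t 2 t) = -1" "unit_ratio (elt t 2 (t + a)) = \<i>" "unit_ratio (elt t 2 (t - a)) = -\<i>"
    using a_nonzero div by (simp_all add: unit_ratio_def C G H)
  have "cnj (1 + inverse D) = D * (1 + inverse D)"
    using D_nonzero by (simp add: cnj_D field_simps)
  then show "unit_ratio (elt t (-1) 1) = inverse D"
    using W0 D_nonzero by (simp add: unit_ratio_def W field_simps)
qed

section \<open>The torsion subgroup\<close>

abbreviation (input) class_I :: "(rat^2^2) set set" where "class_I \<equiv> G_class t (mat 1)"
abbreviation (input) class_C :: "(rat^2^2) set set" where "class_C \<equiv> G_class t (elt t 2 t)"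
abbreviation (input) class_G :: "(rat^2^2) set set" where "class_G \<equiv> G_class t (elt t 2 (t + a))"
abbreviation (input) class_H :: "(rat^2^2) set set" where "class_H \<equiv> G_class t (elt t 2 (t - a))"
abbreviation (input) class_W :: "(rat^2^2) set set" where "class_W \<equiv> G_class t (elt t (-1) 1)"

lemma I_in_R: "mat 1 \<in> carrier (R_nonsing t)"
  by (simp add: mat_in_R_nonsing)

lemmas in_R = I_in_R C_in_R G_in_R H_in_R W_in_R
lemmas unit_ratios = unit_ratio_one unit_ratio_C unit_ratio_G unit_ratio_H unit_ratio_W

lemma class_I_eq_one: "class_I = \<one>\<^bsub>laxton_group t\<^esub>"
  unfolding G_class_eq_one_iff_unit_ratio[OF I_in_R] unit_ratio_one
  by (rule exI[of _ 0]) simp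

lemma G_class_mult_eqI:
  assumes "A \<in> carrier (R_nonsing t)" "B \<in> carrier (R_nonsing t)" "X \<in> carrier (R_nonsing t)"
    and "unit_ratio A * unit_ratio B = unit_ratio X * D powi (2 * k)"
  shows "G_class t A \<otimes>\<^bsub>laxton_group t\<^esub> G_class t B = G_class t X"
proof -
  have "G_class t (A \<otimes>\<^bsub>R_nonsing t\<^esub> B) = G_class t X"
    using assms by (subst G_class_eq_iff) (auto simp: unit_ratio_m)
  then show ?thesis using assms by simp
qed

lemma class_relations:
  "class_G \<otimes>\<^bsub>laxton_group t\<^esub> class_G = class_C"
  "class_G \<otimes>\<^bsub>laxton_group t\<^esub> class_C = class_H"
  "class_C \<otimes>\<^bsub>laxton_group t\<^esub> class_C = \<one>\<^bsub>laxton_group t\<^esub>"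
  "class_W \<otimes>\<^bsub>laxton_group t\<^esub> class_W = \<one>\<^bsub>laxton_group t\<^esub>"
proof -
  show "class_G \<otimes>\<^bsub>laxton_group t\<^esub> class_G = class_C"
    by (rule G_class_mult_eqI[of _ _ _ 0]) (simp_all add: in_R unit_ratios)
  show "class_G \<otimes>\<^bsub>laxton_group t\<^esub> class_C = class_H"
    by (rule G_class_mult_eqI[of _ _ _ 0]) (simp_all add: in_R unit_ratios)
  have "class_C \<otimes>\<^bsub>laxton_group t\<^esub> class_C = class_I"
    by (rule G_class_mult_eqI[of _ _ _ 0]) (simp_all add: in_R unit_ratios)
  then show "class_C \<otimes>\<^bsub>laxton_group t\<^esub> class_C = \<one>\<^bsub>laxton_group t\<^esub>"
    by (simp only: class_I_eq_one)
  have "class_W \<otimes>\<^bsub>laxton_group t\<^esub> class_W = class_I"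
    \<comment> \<open>The ratio of \<open>W\<close> squared is \<open>D powi (-2)\<close>, an even power of \<open>D\<close>.\<close>
    by (rule G_class_mult_eqI[of _ _ _ "-1"])
      (simp_all only: in_R unit_ratios D_powi_double, simp add: power_int_minus)
  then show "class_W \<otimes>\<^bsub>laxton_group t\<^esub> class_W = \<one>\<^bsub>laxton_group t\<^esub>"
    by (simp only: class_I_eq_one)
qed

text \<open>The point \<open>D\<close> is none of \<open>1\<close>, \<open>-1\<close> because \<open>a\<close> is nonzero, and none of \<open>\<i>\<close>, \<open>-\<i>\<close> because \<open>t\<close> is.\<close>

lemma D_not_root_of_unity:
  assumes "t \<noteq> 0" "D powi k = 1"
  shows "k = 0"
proof (rule ccontr)
  assume k: "k \<noteq> 0"
  have "D ^ nat \<bar>k\<bar> = 1"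
  proof (cases "k > 0")
    case False
    then have "inverse (D ^ nat (- k)) = 1"
      using assms(2) k by (simp add: power_int_def power_inverse)
    then show ?thesis using False by simp
  qed (use assms(2) in \<open>simp add: power_int_def\<close>)
  then have "D \<in> {1, -1, \<i>, -\<i>}"
    using k by (intro gaussian_root_of_unity[OF D_gaussian]) auto
  then show False
    using assms(1) a_nonzero by (auto simp: D_def complex_eq_iff)
qed

lemma class_C_neq_one:
  assumes "t \<noteq> 0"
  shows "class_C \<noteq> \<one>\<^bsub>laxton_group t\<^esub>"
proof
  assume "class_C = \<one>\<^bsub>laxton_group t\<^esub>"
  then obtain k where k: "-1 = D powi (2 * k)"
    unfolding G_class_eq_one_iff_unit_ratio[OF C_in_R] unit_ratio_C by blast
  have "D powi (2 * (2 * k)) = (-1) * (-1)"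
    unfolding D_powi_double[of "2 * k"] k[symmetric] ..
  then have "2 * (2 * k) = 0" by (intro D_not_root_of_unity[OF assms]) simp
  then show False using k by simp
qed

text \<open>An equality with one of the four classes would make an odd power of \<open>D\<close> a fourth root of unity.\<close>

lemma class_W_notin:
  assumes "t \<noteq> 0"
  shows "class_W \<notin> {\<one>\<^bsub>laxton_group t\<^esub>, class_C, class_G, class_H}"
proof
  assume "class_W \<in> {\<one>\<^bsub>laxton_group t\<^esub>, class_C, class_G, class_H}"
  then obtain X where X: "X \<in> carrier (R_nonsing t)" "unit_ratio X ^ 4 = 1" "class_W = G_class t X"
    unfolding class_I_eq_one[symmetric]
    by (elim insertE emptyE) (use in_R unit_ratios in \<open>force simp: power4_eq_xxxx\<close>)+
  then obtain k where "inverse D = unit_ratio X * D powi (2 * k)"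
    by (auto simp: G_class_eq_iff W_in_R unit_ratio_W)
  then have "inverse D ^ 4 = (D powi (2 * k)) ^ 4"
    using X(2) by (simp add: power_mult_distrib)
  moreover have "inverse D ^ 4 * D ^ 4 = 1"
    using D_nonzero by (simp flip: power_mult_distrib)
  ultimately have "(D powi (2 * k)) ^ 4 * D ^ 4 = 1" by simp
  moreover have "D powi (8 * k + 4) = D powi (8 * k) * D powi 4"
    by (rule power_int_add) (simp add: D_nonzero)
  moreover have "(D powi (2 * k)) ^ 4 = D powi (2 * k * int 4)"
    by (rule power_int_power')
  moreover have "2 * k * int 4 = 8 * k" by simp
  ultimately have "D powi (8 * k + 4) = 1" by simp
  then have "8 * k + 4 = 0" by (rule D_not_root_of_unity[OF assms])
  then show False by presburger
qed

text \<open>The primitivity hypotheses say exactly what is needed about \<open>D\<close>: the doubled real parts of \<open>D\<close>, \<open>\<i> D\<close> and \<open>- \<i> D\<close> are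
  \<open>t\<close>, \<open>- a\<close> and \<open>a\<close>, so \<open>D\<close> is no proper power and none of its multiples by fourth roots of unity is a square.  Hence the ratio of a
  torsion element is \<open>\<epsilon> * D powi j\<close>, and the parity of \<open>j\<close> decides whether the element is one of the four classes or a translate of one by \<open>W\<close>.\<close>

lemma torsion_covered:
  assumes "r_primitive 2 a" "r_primitive 2 (- a)" "primitive t"
    and X: "X \<in> torsion (laxton_group t)"
  shows "X \<in> {class_I, class_C, class_G, class_H} \<union>
    (\<lambda>Y. class_W \<otimes>\<^bsub>laxton_group t\<^esub> Y) ` {class_I, class_C, class_G, class_H}"
proof -
  obtain n :: nat where n: "n > 0" "X [^]\<^bsub>laxton_group t\<^esub> n = \<one>\<^bsub>laxton_group t\<^esub>"
    and "X \<in> carrier (laxton_group t)" using X by (auto simp: torsion_def)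
  then obtain A where A: "A \<in> carrier (R_nonsing t)" and XA: "X = G_class t A"
    by (auto simp: carrier_laxton)
  have "G_class t (A [^]\<^bsub>R_nonsing t\<^esub> n) = \<one>\<^bsub>laxton_group t\<^esub>"
    using n A by (simp add: XA q.hom_nat_pow)
  then obtain k where k: "unit_ratio A ^ n = D powi (2 * k)"
    using A by (auto simp: G_class_eq_one_iff_unit_ratio unit_ratio_nat_pow)
  have nonpower: "w ^ r \<noteq> D" if "r \<ge> 2" "w \<in> gaussian_rats" "norm w = 1" for r w
    using that assms(3) by (intro r_primitive_nonpower[of r t]) (auto simp: primitive_def D_def)
  have nonsquare: "w\<^sup>2 \<noteq> \<epsilon> * D"
    if w: "w \<in> gaussian_rats" "norm w = 1" and \<epsilon>: "\<epsilon> \<in> gaussian_rats" "\<epsilon> ^ 4 = 1" for w \<epsilon>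
  proof -
    have "\<epsilon> \<in> {1, -1, \<i>, -\<i>}" using gaussian_root_of_unity[OF \<epsilon>] by simp
    moreover have "w\<^sup>2 \<noteq> D" using nonpower[of 2 w] w by simp
    moreover have "w\<^sup>2 \<noteq> - D"
    \<comment> \<open>Here \<open>-1\<close> is itself a square, so this case reduces to \<open>D\<close>.\<close>
    proof
      assume "w\<^sup>2 = - D"
      then have "(\<i> * w)\<^sup>2 = D" by (simp add: power_mult_distrib)
      moreover have "\<i> * w \<in> gaussian_rats" "norm (\<i> * w) = 1"
        using w by (auto simp: norm_mult)
      ultimately show False using nonpower[of 2] by blast
    qed
    moreover have "w\<^sup>2 \<noteq> \<i> * D"
      using assms(2) w by (intro r_primitive_nonpower[of 2 "-a"]) (auto simp: D_def of_rat_minus)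
    moreover have "w\<^sup>2 \<noteq> - \<i> * D"
      using assms(1) w by (intro r_primitive_nonpower[of 2 a]) (auto simp: D_def)
    ultimately show ?thesis by auto
  qed
  obtain \<epsilon> j where \<epsilon>: "\<epsilon> \<in> gaussian_rats" "\<epsilon> ^ 4 = 1" and u: "unit_ratio A = \<epsilon> * D powi j"
    using torsion_modulo_nonpower[OF D_gaussian norm_D unit_ratio_gaussian norm_unit_ratio[OF A] n(1) k]
      nonpower nonsquare by blast
  have "\<epsilon> \<in> {1, -1, \<i>, -\<i>}" using gaussian_root_of_unity[OF \<epsilon>] by simp
  then obtain Y where Y: "Y \<in> carrier (R_nonsing t)" "unit_ratio Y = \<epsilon>"
    "G_class t Y \<in> {class_I, class_C, class_G, class_H}"
    by (elim insertE emptyE) (use in_R unit_ratios in blast)+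
  \<comment> \<open>The representative \<open>Y\<close> carries \<open>\<epsilon>\<close>; an odd \<open>j\<close> needs the additional factor \<open>inverse D\<close> of \<open>W\<close>.\<close>
  show ?thesis
  proof (cases "even j")
    case True
    then obtain l where "j = 2 * l" by blast
    then have "X = G_class t Y"
      unfolding XA using Y A u by (subst G_class_eq_iff) auto
    then show ?thesis using Y(3) by blast
  next
    case False
    then obtain l where l: "j = 2 * l + 1" by (blast elim: oddE)
    have "\<epsilon> * D powi j * D powi (2 * (- l - 1)) = \<epsilon> * D powi (j + 2 * (- l - 1))"
      using D_nonzero by (simp add: power_int_add)
    also have "j + 2 * (- l - 1) = -1" by (simp add: l)
    finally have "inverse D * \<epsilon> = unit_ratio A * D powi (2 * (- l - 1))"
      unfolding u power_int_minus power_int_1_right by (simp only: mult.commute)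
    then have "class_W \<otimes>\<^bsub>laxton_group t\<^esub> G_class t Y = X"
      unfolding XA using Y A by (intro G_class_mult_eqI[where k = "- l - 1"]) (simp_all only: unit_ratio_W W_in_R)
    then show ?thesis using Y(3) by blast
  qed
qed

lemma torsion_structure:
  assumes "t \<noteq> 0" "r_primitive 2 a" "r_primitive 2 (- a)" "primitive t"
  shows
    "let T = (laxton_group t)\<lparr>carrier := torsion (laxton_group t)\<rparr>;
         S = {class_I, class_C, class_G, class_H}
     in T \<cong> integer_mod_group 2 \<times>\<times> integer_mod_group 4 \<and>
        subgroup S T \<and>
        T\<lparr>carrier := S\<rparr> \<cong> integer_mod_group 4 \<and>
        carrier T - S = (\<lambda>X. class_W \<otimes>\<^bsub>T\<^esub> X) ` S"
proof -
  define T where "T = (laxton_group t)\<lparr>carrier := torsion (laxton_group t)\<rparr>"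
  define S where "S = {class_I, class_C, class_G, class_H}"
  have sub: "subgroup (torsion (laxton_group t)) (laxton_group t)"
    by (rule subgroup_torsion[OF comm_group_laxton_group])
  have mult: "x \<otimes>\<^bsub>T\<^esub> y = x \<otimes>\<^bsub>laxton_group t\<^esub> y" and one: "\<one>\<^bsub>T\<^esub> = \<one>\<^bsub>laxton_group t\<^esub>" for x y
    by (simp_all add: T_def)
  have carT: "carrier T = torsion (laxton_group t)" by (simp add: T_def)
  interpret T: comm_group T
  proof (rule group.group_comm_groupI)
    show "group T" unfolding T_def by (rule Q.subgroup_imp_group[OF sub])
    fix x y assume "x \<in> carrier T" "y \<in> carrier T"
    then show "x \<otimes>\<^bsub>T\<^esub> y = y \<otimes>\<^bsub>T\<^esub> x"
      unfolding mult carT torsion_def by (intro Q.m_comm) simp_all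
  qed
  have rel: "class_G \<otimes>\<^bsub>T\<^esub> class_G = class_C" "class_G \<otimes>\<^bsub>T\<^esub> class_C = class_H"
    "class_C \<otimes>\<^bsub>T\<^esub> class_C = \<one>\<^bsub>T\<^esub>" "class_W \<otimes>\<^bsub>T\<^esub> class_W = \<one>\<^bsub>T\<^esub>"
    unfolding mult one by (rule class_relations)+
  have nat_pow_2: "x [^]\<^bsub>laxton_group t\<^esub> (2 :: nat) = x \<otimes>\<^bsub>laxton_group t\<^esub> x"
    if "x \<in> carrier (laxton_group t)" for x
    using that by (simp add: numeral_2_eq_2)
  have W: "class_W \<in> carrier T"
    unfolding carT torsion_def using class_relations(4) nat_pow_2[of class_W] W_in_R
    by (auto intro!: exI[of _ 2])
  have "class_G [^]\<^bsub>laxton_group t\<^esub> (2 * 2 :: nat) = \<one>\<^bsub>laxton_group t\<^esub>"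
    using class_relations nat_pow_2[of class_G] nat_pow_2[of class_C] G_in_R C_in_R
    by (simp only: Q.nat_pow_pow[symmetric] q.hom_closed)
  then have G: "class_G \<in> carrier T"
    unfolding carT torsion_def using G_in_R by (auto intro!: exI[of _ 4])
  have SE: "S = {\<one>\<^bsub>T\<^esub>, class_C, class_G, class_H}"
    unfolding S_def one class_I_eq_one ..
  have C1: "class_C \<noteq> \<one>\<^bsub>T\<^esub>" and WS: "class_W \<notin> S"
    unfolding SE one by (rule class_C_neq_one[OF assms(1)], rule class_W_notin[OF assms(1)])
  note facts = G W rel C1 SE WS
  have "S \<subseteq> carrier T" by (rule subgroup.subset[OF T.subgroup_S[OF facts]])
  then have cover: "carrier T = S \<union> (\<lambda>X. class_W \<otimes>\<^bsub>T\<^esub> X) ` S"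
    using torsion_covered[OF assms(2-4)] W unfolding mult S_def[symmetric] carT[symmetric]
    by (auto simp flip: mult)
  show ?thesis
    unfolding Let_def T_def[symmetric] S_def[symmetric]
    using T.iso_Z2_Z4[OF facts cover] T.subgroup_S[OF facts] T.S_iso_Z4[OF facts]
      T.complement_S[OF facts cover] by blast
qed

end

theorem proposition21:
  fixes t a :: rat
  assumes "t \<notin> {0, 1, -1, 2, -2}"
    and "circular t" and "t\<^sup>2 + a\<^sup>2 = 4"
    and "primitive t" and "circular_primitive t"
  shows
    "let T = (laxton_group t)\<lparr>carrier := torsion (laxton_group t)\<rparr>;
         I = G_class t (mat 1);
         C = G_class t (elt t 2 t);
         G = G_class t (elt t 2 (t + a));
         H = G_class t (elt t 2 (t - a));
         S = {I, C, G, H};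
         W = G_class t (elt t (-1) 1)
     in T \<cong> integer_mod_group 2 \<times>\<times> integer_mod_group 4 \<and>
        subgroup S T \<and>
        T\<lparr>carrier := S\<rparr> \<cong> integer_mod_group 4 \<and>
        carrier T - S = (\<lambda>X. W \<otimes>\<^bsub>T\<^esub> X) ` S"
proof -
  have "a \<noteq> 0"
  proof
    assume "a = 0"
    then have "t\<^sup>2 = 2\<^sup>2" using assms(3) by simp
    then show False using assms(1) by (simp only: power2_eq_iff) simp
  qed
  then interpret circular_parameter t a
    using assms(3) by unfold_locales
  have "r_primitive 2 a" "r_primitive 2 (- a)"
    using assms(3,5) by (auto simp: circular_primitive_def associate_values_def)
  then show ?thesis
    using torsion_structure assms(1,4) by (simp add: Let_def)
qed

end
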